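(* Let $\mathcal{F}:\mathcal{L}_n\to\mathcal{L}_n$ (of the form $\mathcal{F}(x(\cdot))(\xi)=F(x(\xi),\xi)$) be continuous, and assume that $\mathcal{F}$ is pseudomonotone on $\mathcal{C}\cap\mathcal{N}_n$. Then the following three statements are equivalent. (a) There exists $\hat{x}(\cdot)\in\mathcal{C}\cap\mathcal{N}_n$ such that the set $$L_<=\{x(\cdot)\in\mathcal{C}\cap\mathcal{N}_n:\langle\mathcal{F}(x(\cdot)),x(\cdot)-\hat{x}(\cdot)\rangle<0\}$$ is bounded (possibly empty). (b) There exist a bounded open set $\Omega\subset\mathcal{L}_n$ and some $\hat{x}(\cdot)\in\mathcal{C}\cap\mathcal{N}_n\cap\Omega$ such that $$\langle\mathcal{F}(x(\cdot)),x(\cdot)-\hat{x}(\cdot)\rangle\ge 0\quad\text{for all } x(\cdot)\in\mathcal{C}\cap\mathcal{N}_n\cap\mathrm{bd}\,\Omega.$$ (c) The problem $\mathrm{SVI}(\mathcal{C}\cap\mathcal{N}_n,\mathcal{F})$ has a solution. Moreover, if there exists some $\hat{x}(\cdot)\in\mathcal{C}\cap\mathcal{N}_n$ such that the set $$L_{\le}=\{x(\cdot)\in\mathcal{C}\cap\mathcal{N}_n:\langle\mathcal{F}(x(\cdot)),x(\cdot)-\hat{x}(\cdot)\rangle\le 0\}$$ is bounded, then $\mathrm{SOL}(\mathcal{C}\cap\mathcal{N}_n,\mathcal{F})$ is nonempty and compact.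
   Context: Let $N\ge1$ and $n_1,\dots,n_N\ge 1$ be integers, $n=\sum_{k=1}^N n_k$. Let $\Xi=\Xi_1\times\cdots\times\Xi_N$ be a finite sample space whose elements $\xi=(\xi_1,\dots,\xi_N)$ have probabilities $p(\xi)>0$ summing to $1$. $\mathcal{L}_n$ is the Hilbert space of all maps $x(\cdot):\Xi\to\mathbb{R}^n$, $x(\xi)=(x_1(\xi),\dots,x_N(\xi))$ with $x_k(\xi)\in\mathbb{R}^{n_k}$, with inner product $\langle x(\cdot),w(\cdot)\rangle=\sum_{\xi\in\Xi}p(\xi)\sum_{k=1}^N\langle x_k(\xi),w_k(\xi)\rangle$. The nonanticipativity subspace is $\mathcal{N}_n=\{x(\cdot)\in\mathcal{L}_n: x_k(\xi)\text{ does not depend on }\xi_k,\dots,\xi_N,\ k=1,\dots,N\}$. For each $\xi\in\Xi$ let $C(\xi)\subset\mathbb{R}^n$ be nonempty closed convex, and $\mathcal{C}=\{x(\cdot)\in\mathcal{L}_n:x(\xi)\in C(\xi)\ \forall\xi\in\Xi\}$. The mapping $\mathcal{F}$ is given by $\mathcal{F}(x(\cdot)):\xi\mapsto F(x(\xi),\xi)$, where $F(\cdot,\xi):\mathbb{R}^n\to\mathbb{R}^n$ for each $\xi$. $\mathrm{SVI}(\mathcal{C}\cap\mathcal{N}_n,\mathcal{F})$ is the problem of finding $x(\cdot)\in\mathcal{C}\cap\mathcal{N}_n$ with $-\mathcal{F}(x(\cdot))\in N_{\mathcal{C}\cap\mathcal{N}_n}(x(\cdot))$, i.e. $\langle\mathcal{F}(x(\cdot)),y(\cdot)-x(\cdot)\rangle\ge0$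 for all $y(\cdot)\in\mathcal{C}\cap\mathcal{N}_n$; $\mathrm{SOL}(\mathcal{C}\cap\mathcal{N}_n,\mathcal{F})$ is its solution set. $\mathcal{F}$ is pseudomonotone on a set $\mathcal{K}\subset\mathcal{L}_n$ if for all $x(\cdot),y(\cdot)\in\mathcal{K}$: $\langle y(\cdot)-x(\cdot),\mathcal{F}(x(\cdot))\rangle\ge0$ implies $\langle y(\cdot)-x(\cdot),\mathcal{F}(y(\cdot))\rangle\ge0$. $\mathrm{bd}$ denotes the (topological) boundary. *)

theory Defs
  imports "HOL-Analysis.Analysis"
begin

text \<open>
  Encoding. The decision space \<open>\<real>\<^sup>n\<close> is \<open>real ^ 'n\<close>. A map \<open>stg :: 'n \<Rightarrow> nat\<close> assigns to every coordinate
  the stage \<open>k \<in> {1..N}\<close> it belongs to, and the block \<open>x\<^sub>k \<in> \<real>\<^bsup>n\<^sub>k\<^esup>\<close> consists of the \<open>n\<^sub>k\<close> coordinates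
  \<open>i\<close> with \<open>stg i = k\<close>.

  The finite sample space is a finite type \<open>'xi\<close>. A map \<open>coord :: 'xi \<Rightarrow> nat \<Rightarrow> 's\<close>, bijective onto
  \<open>PiE {1..N} Xi\<close>, identifies it with the product \<open>Xi 1 \<times> \<dots> \<times> Xi N\<close>; \<open>coord \<xi> j\<close> is the component
  \<open>\<xi>\<^sub>j\<close>. All the factors \<open>Xi j\<close> are taken as sets over one common type \<open>'s\<close>.

  The space \<open>\<L>\<^sub>n\<close> of all maps from the sample space to \<open>\<real>\<^sup>n\<close> is the type \<open>real ^ 'n ^ 'xi\<close>, with
  \<open>x $ \<xi>\<close> in the role of \<open>x(\<xi>)\<close>. Its inner product is the weighted one defined next, not the inner
  product \<open>\<bullet>\<close> of the type. The norm of the type is equivalent to the weighted norm (shown in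
  \<open>wnorm_equivalent\<close>), so that open, bounded and compact sets, boundaries and continuity are the
  same for both and the library notions are used for them.
\<close>

definition winner :: "('xi::finite \<Rightarrow> real) \<Rightarrow> real ^ 'n ^ 'xi \<Rightarrow> real ^ 'n ^ 'xi \<Rightarrow> real" where
  "winner p x w = (\<Sum>\<xi>\<in>UNIV. p \<xi> * (x $ \<xi> \<bullet> w $ \<xi>))"

definition nonanticipative ::
  "nat \<Rightarrow> ('n::finite \<Rightarrow> nat) \<Rightarrow> ('xi::finite \<Rightarrow> nat \<Rightarrow> 's) \<Rightarrow> (real ^ 'n ^ 'xi) set" where
  "nonanticipative N stg coord =
     {x. \<forall>k\<in>{1..N}. \<forall>\<xi> \<xi>'. (\<forall>j\<in>{1..<k}. coord \<xi> j = coord \<xi>' j) \<longrightarrow>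
           (\<forall>i. stg i = k \<longrightarrow> x $ \<xi> $ i = x $ \<xi>' $ i)}"

definition constraint_set :: "('xi::finite \<Rightarrow> (real ^ 'n) set) \<Rightarrow> (real ^ 'n ^ 'xi) set" where
  "constraint_set C = {x. \<forall>\<xi>. x $ \<xi> \<in> C \<xi>}"

definition pointwise_map ::
  "(real ^ 'n \<Rightarrow> 'xi::finite \<Rightarrow> real ^ 'n) \<Rightarrow> real ^ 'n ^ 'xi \<Rightarrow> real ^ 'n ^ 'xi" where
  "pointwise_map F x = (\<chi> \<xi>. F (x $ \<xi>) \<xi>)"

definition pseudomonotone_on ::
  "('xi::finite \<Rightarrow> real) \<Rightarrow> (real ^ 'n ^ 'xi) set \<Rightarrow> (real ^ 'n ^ 'xi \<Rightarrow> real ^ 'n ^ 'xi) \<Rightarrow> bool" where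
  "pseudomonotone_on p K G \<longleftrightarrow>
     (\<forall>x\<in>K. \<forall>y\<in>K. winner p (y - x) (G x) \<ge> 0 \<longrightarrow> winner p (y - x) (G y) \<ge> 0)"

definition normal_cone ::
  "('xi::finite \<Rightarrow> real) \<Rightarrow> (real ^ 'n ^ 'xi) set \<Rightarrow> real ^ 'n ^ 'xi \<Rightarrow> (real ^ 'n ^ 'xi) set" where
  "normal_cone p K x = {v. x \<in> K \<and> (\<forall>y\<in>K. winner p v (y - x) \<le> 0)}"

definition SOL ::
  "('xi::finite \<Rightarrow> real) \<Rightarrow> (real ^ 'n ^ 'xi) set \<Rightarrow> (real ^ 'n ^ 'xi \<Rightarrow> real ^ 'n ^ 'xi)
     \<Rightarrow> (real ^ 'n ^ 'xi) set" where
  "SOL p K G = {x \<in> K. - G x \<in> normal_cone p K x}"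

lemma SOL_iff: "x \<in> SOL p K G \<longleftrightarrow> x \<in> K \<and> (\<forall>y\<in>K. winner p (G x) (y - x) \<ge> 0)"
  by (auto simp: SOL_def normal_cone_def winner_def sum_negf)

lemma winner_blocks:
  fixes stg :: "'n::finite \<Rightarrow> nat"
  assumes "\<And>i. stg i \<in> {1..N}"
  shows "winner p x w = (\<Sum>\<xi>\<in>UNIV. p \<xi> * (\<Sum>k=1..N. \<Sum>i | stg i = k. x $ \<xi> $ i * w $ \<xi> $ i))"
proof -
  have "(\<Sum>k=1..N. \<Sum>i | stg i = k. f i) = (\<Sum>i\<in>UNIV. f i)" for f :: "'n \<Rightarrow> real"
    using sum.group[of UNIV "{1..N}" stg f] assms by (simp add: image_subset_iff)
  then show ?thesis
    by (simp add: winner_def inner_vec_def)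
qed

lemma wnorm_equivalent:
  fixes p :: "'xi::finite \<Rightarrow> real"
  assumes pos: "\<And>\<xi>. p \<xi> > 0" and sum1: "(\<Sum>\<xi>\<in>UNIV. p \<xi>) = 1"
  obtains c where "c > 0"
    and "\<And>x :: real ^ 'n ^ 'xi. c * norm x \<le> sqrt (winner p x x)"
    and "\<And>x :: real ^ 'n ^ 'xi. sqrt (winner p x x) \<le> norm x"
proof -
  define m where "m = Min (range p)"
  have m0: "m > 0" using pos by (simp add: m_def)
  have mp: "m \<le> p \<xi>" for \<xi> by (simp add: m_def)
  have p1: "p \<xi> \<le> 1" for \<xi>
    using member_le_sum[of \<xi> UNIV p] pos sum1 by (simp add: less_imp_le)
  have n: "(norm x)\<^sup>2 = (\<Sum>\<xi>\<in>UNIV. x $ \<xi> \<bullet> x $ \<xi>)" for x :: "real ^ 'n ^ 'xi"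
    by (simp add: power2_norm_eq_inner inner_vec_def)
  have lo: "m * (norm x)\<^sup>2 \<le> winner p x x" for x :: "real ^ 'n ^ 'xi"
    unfolding n winner_def sum_distrib_left by (intro sum_mono mult_right_mono mp) simp
  have hi: "winner p x x \<le> (norm x)\<^sup>2" for x :: "real ^ 'n ^ 'xi"
    unfolding n winner_def using p1 by (intro sum_mono mult_left_le_one_le) (auto intro: less_imp_le pos)
  show ?thesis
  proof
    show "sqrt m > 0" using m0 by simp
    show "sqrt m * norm x \<le> sqrt (winner p x x)" for x :: "real ^ 'n ^ 'xi"
      using real_sqrt_le_mono[OF lo[of x]] by (simp add: real_sqrt_mult)
    show "sqrt (winner p x x) \<le> norm x" for x :: "real ^ 'n ^ 'xi"
      using real_sqrt_le_mono[OF hi[of x]] by simp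
  qed
qed

end

theory Submission
  imports Defs
begin

text \<open>
  Absorbing the weights into the operator turns the problem into a variational inequality for the
  plain inner product: \<open>winner p (G x) d\<close> is \<open>H x \<bullet> d\<close> for the operator \<open>H\<close> that multiplies each
  component \<open>G x $ \<xi>\<close> by \<open>p \<xi>\<close> (\<open>winner_eq_inner_weighted\<close>). The set \<open>K\<close> is closed and convex, being the
  intersection of a closed convex set with a subspace. So it suffices to treat a continuous
  pseudomonotone operator \<open>H\<close> on a closed convex set of a Euclidean space.

  The implications from a solution to (a) and from (a) to (b) are short. If \<open>z\<close> is a solution,
  pseudomonotonicity gives \<open>H x \<bullet> (x - z) \<ge> 0\<close> throughout \<open>K\<close>, so that \<open>L\<^sub><\<close> is empty for the centre \<open>z\<close>.
  If \<open>L\<^sub><\<close> is bounded, any large ball serves as \<open>\<Omega>\<close>.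

  The substance is the passage from (b) to a solution (\<open>vi_solution_if_nonneg_on_frontier\<close>), where
  pseudomonotonicity allows Brouwer's theorem on a ball to replace degree theory on \<open>\<Omega>\<close>. Brouwer
  yields a solution \<open>z\<close> of the inequality on the part of \<open>K\<close> inside a ball that contains the closure of
  \<open>\<Omega>\<close> in its interior. Such a \<open>z\<close> solves the inequality on all of \<open>K\<close> as soon as some \<open>w \<in> K\<close>
  in the interior of the ball satisfies \<open>H z \<bullet> (w - z) \<le> 0\<close>: a short step from \<open>w\<close> in any direction of \<open>K\<close>
  stays in the ball (\<open>vi_solution_if_solution_on_ball\<close>). If \<open>z\<close> lies outside
  the closure of \<open>\<Omega>\<close>, the segment from \<open>xh\<close> to \<open>z\<close> leaves \<open>\<Omega>\<close> at a boundary point \<open>w\<close>. There (b) gives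
  \<open>H w \<bullet> (w - xh) \<ge> 0\<close>; as \<open>z - w\<close> and \<open>w - xh\<close> have the same direction, \<open>H w \<bullet> (z - w) \<ge> 0\<close>, and
  pseudomonotonicity carries this over to \<open>H z \<bullet> (z - w) \<ge> 0\<close>. So \<open>w\<close> is a point of the required kind.

  For the last claim, testing a solution \<open>x\<close> against \<open>xh\<close> gives \<open>H x \<bullet> (x - xh) \<le> 0\<close>. So the solutions,
  which form a closed set by continuity, all lie in \<open>L\<^sub>\<le>\<close>; and \<open>L\<^sub>\<le>\<close> contains \<open>L\<^sub><\<close>, so that its
  boundedness also provides existence.
\<close>

section \<open>Variational inequalities in Euclidean spaces\<close>

definition vi_solutions :: "'a::real_inner set \<Rightarrow> ('a \<Rightarrow> 'a) \<Rightarrow> 'a set" where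
  "vi_solutions K H = {x \<in> K. \<forall>y\<in>K. 0 \<le> H x \<bullet> (y - x)}"

definition pseudomonotone :: "'a::real_inner set \<Rightarrow> ('a \<Rightarrow> 'a) \<Rightarrow> bool" where
  "pseudomonotone K H \<longleftrightarrow> (\<forall>x\<in>K. \<forall>y\<in>K. 0 \<le> H x \<bullet> (y - x) \<longrightarrow> 0 \<le> H y \<bullet> (y - x))"

text \<open>
  This is the theorem of Hartman and Stampacchia. A point \<open>x\<close> is a solution exactly if it is the
  projection of \<open>x - H x\<close> onto \<open>K\<close>, so Brouwer's theorem applies to the composite map.
\<close>

lemma vi_solution_exists_compact:
  fixes H :: "'a::euclidean_space \<Rightarrow> 'a"
  assumes "compact K" and "convex K" and "K \<noteq> {}" and "continuous_on K H"
  shows "vi_solutions K H \<noteq> {}"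
proof -
  have "closed K" using assms(1) by (rule compact_imp_closed)
  let ?T = "\<lambda>x. closest_point K (x - H x)"
  have "continuous_on K ?T"
    by (rule continuous_on_compose2[OF
          continuous_on_closest_point[OF \<open>convex K\<close> \<open>closed K\<close> \<open>K \<noteq> {}\<close>, of UNIV]])
      (auto intro: continuous_on_diff continuous_on_id assms(4))
  moreover have "?T \<in> K \<rightarrow> K"
    using closest_point_in_set[OF \<open>closed K\<close> \<open>K \<noteq> {}\<close>] by auto
  ultimately obtain x where x: "x \<in> K" "?T x = x"
    using brouwer[OF assms(1-3)] by blast
  have "0 \<le> H x \<bullet> (y - x)" if "y \<in> K" for y
    using closest_point_dot[OF \<open>convex K\<close> \<open>closed K\<close> that, of "x - H x"] x(2) by simp
  with x(1) show ?thesis by (auto simp: vi_solutions_def)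
qed

text \<open>
  Since \<open>H z \<bullet> (w - z) \<le> 0\<close>, testing \<open>z\<close> against a point \<open>w + t *\<^sub>R (y - w)\<close> bounds \<open>t * (H z \<bullet> (y - z))\<close> from
  below, and for small \<open>t > 0\<close> this point lies in the ball because \<open>w\<close> is in its interior. The point
  \<open>z\<close> itself may lie on the boundary of the ball.
\<close>

lemma vi_solution_if_solution_on_ball:
  fixes H :: "'a::real_inner \<Rightarrow> 'a"
  assumes "convex K"
    and z: "z \<in> vi_solutions (K \<inter> cball a R) H"
    and w: "w \<in> K" "dist a w < R" "H z \<bullet> (w - z) \<le> 0"
  shows "z \<in> vi_solutions K H"
proof -
  have "0 \<le> H z \<bullet> (y - z)" if "y \<in> K" for y
  proof -
    have "((\<lambda>t. dist a (w + t *\<^sub>R (y - w))) \<longlongrightarrow> dist a (w + 0 *\<^sub>R (y - w))) (at_right 0)"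
      by (intro tendsto_intros)
    then have "\<forall>\<^sub>F t in at_right 0. dist a (w + t *\<^sub>R (y - w)) < R"
      using w(2) by (intro order_tendstoD(2)) auto
    moreover have "\<forall>\<^sub>F t in at_right 0. t \<in> {0<..<1::real}"
      by (intro eventually_at_right_real) simp
    ultimately have "\<forall>\<^sub>F t in at_right 0. dist a (w + t *\<^sub>R (y - w)) < R \<and> t \<in> {0<..<1}"
      by (rule eventually_conj)
    then obtain t :: real where t: "dist a (w + t *\<^sub>R (y - w)) < R" "0 < t" "t < 1"
      using eventually_happens by force
    have "w + t *\<^sub>R (y - w) = (1 - t) *\<^sub>R w + t *\<^sub>R y"
      by (simp add: algebra_simps)
    then have "w + t *\<^sub>R (y - w) \<in> K"
      using convexD[OF \<open>convex K\<close> w(1) that, of "1 - t" t] t by simp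
    then have "0 \<le> H z \<bullet> (w + t *\<^sub>R (y - w) - z)"
      using z t(1) by (auto simp: vi_solutions_def)
    also have "\<dots> = (1 - t) * (H z \<bullet> (w - z)) + t * (H z \<bullet> (y - z))"
      by (simp add: algebra_simps)
    also have "\<dots> \<le> t * (H z \<bullet> (y - z))"
      using w(3) t(3) by (simp add: mult_nonneg_nonpos)
    finally show ?thesis using t(2) by (simp add: zero_le_mult_iff)
  qed
  with z show ?thesis by (auto simp: vi_solutions_def)
qed

text \<open>
  The solution \<open>z\<close> on a ball around the closure of \<open>\<Omega>\<close> is also a solution on \<open>K\<close>, by
  \<open>vi_solution_if_solution_on_ball\<close> with \<open>w = z\<close> or with \<open>w\<close> a point of the boundary of \<open>\<Omega>\<close> on the segment
  from \<open>xh\<close> to \<open>z\<close>. Such a \<open>w\<close> exists because the segment is connected.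
\<close>

lemma vi_solution_if_nonneg_on_frontier:
  fixes H :: "'a::euclidean_space \<Rightarrow> 'a"
  assumes "closed K" and "convex K" and "continuous_on K H" and "pseudomonotone K H"
    and "bounded \<Omega>" and "open \<Omega>" and xh: "xh \<in> K" "xh \<in> \<Omega>"
    and frontier: "\<And>x. x \<in> K \<Longrightarrow> x \<in> frontier \<Omega> \<Longrightarrow> 0 \<le> H x \<bullet> (x - xh)"
  shows "vi_solutions K H \<noteq> {}"
proof -
  obtain R where R: "closure \<Omega> \<subseteq> ball xh R"
    using bounded_subset_ballD[OF bounded_closure[OF \<open>bounded \<Omega>\<close>]] by blast
  let ?B = "K \<inter> cball xh R"
  have xh_ball: "xh \<in> ball xh R" using R xh(2) closure_subset by blast
  have "vi_solutions ?B H \<noteq> {}"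
  proof (rule vi_solution_exists_compact)
    show "compact ?B" using \<open>closed K\<close> by (simp add: closed_Int_compact)
    show "convex ?B" using \<open>convex K\<close> by (simp add: convex_Int)
    show "?B \<noteq> {}" using xh(1) xh_ball by auto
    show "continuous_on ?B H" using assms(3) by (rule continuous_on_subset) auto
  qed
  then obtain z where z: "z \<in> vi_solutions ?B H" by blast
  then have zK: "z \<in> K" by (auto simp: vi_solutions_def)
  have "z \<in> vi_solutions K H"
  proof (cases "z \<in> closure \<Omega>")
    case True
    then show ?thesis
      using vi_solution_if_solution_on_ball[OF \<open>convex K\<close> z zK] R by auto
  next
    case False
    then have "z \<notin> \<Omega>" using closure_subset by blast
    then have "closed_segment xh z \<inter> frontier \<Omega> \<noteq> {}"
      using xh(2) by (intro connected_Int_frontier) auto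
    then obtain w where w: "w \<in> closed_segment xh z" "w \<in> frontier \<Omega>" by blast
    then obtain t where t: "0 \<le> t" "t \<le> 1" and w_eq: "w = (1 - t) *\<^sub>R xh + t *\<^sub>R z"
      by (auto simp: in_segment)
    have wcl: "w \<in> closure \<Omega>" using w(2) by (simp add: frontier_def)
    have wK: "w \<in> K"
      using w(1) closed_segment_subset[OF xh(1) zK \<open>convex K\<close>] by blast
    have w_ball: "dist xh w < R" using wcl R by auto
    have "t < 1" using wcl False w_eq t by (cases "t = 1") auto
    have w_xh: "w - xh = t *\<^sub>R (z - xh)"
      by (simp add: w_eq algebra_simps)
    have "t \<noteq> 0"
    proof
      assume "t = 0"
      then have "w = xh" by (simp add: w_eq)
      then show False
        using w(2) xh(2) \<open>open \<Omega>\<close> by (simp add: frontier_def interior_open)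
    qed
    then have lower: "0 \<le> H w \<bullet> (z - xh)"
      using frontier[OF wK w(2)] t by (simp add: w_xh zero_le_mult_iff)
    have "z - w = (1 - t) *\<^sub>R (z - xh)"
      by (simp add: w_eq algebra_simps)
    then have "0 \<le> H w \<bullet> (z - w)"
      using lower \<open>t < 1\<close> by simp
    then have "0 \<le> H z \<bullet> (z - w)"
      using \<open>pseudomonotone K H\<close> zK wK by (auto simp: pseudomonotone_def)
    then show ?thesis
      using vi_solution_if_solution_on_ball[OF \<open>convex K\<close> z wK w_ball]
      by (simp add: inner_diff_right)
  qed
  then show ?thesis by blast
qed

text \<open>
  This is one half of Minty's lemma. With a solution as centre, it makes \<open>L\<^sub><\<close> empty and lets every ball
  around the solution serve as \<open>\<Omega>\<close>.
\<close>

lemma vi_solution_imp_dual_solution: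
  assumes "pseudomonotone K H" and "z \<in> vi_solutions K H" and "x \<in> K"
  shows "0 \<le> H x \<bullet> (x - z)"
  using assms by (auto simp: pseudomonotone_def vi_solutions_def)

lemma exists_open_bounded_iff_vi_solution:
  fixes H :: "'a::euclidean_space \<Rightarrow> 'a"
  assumes "closed K" and "convex K" and "continuous_on K H" and pm: "pseudomonotone K H"
  shows "(\<exists>\<Omega>. bounded \<Omega> \<and> open \<Omega> \<and>
      (\<exists>xh\<in>K \<inter> \<Omega>. \<forall>x\<in>K \<inter> frontier \<Omega>. 0 \<le> H x \<bullet> (x - xh))) \<longleftrightarrow> vi_solutions K H \<noteq> {}"
    (is "?b \<longleftrightarrow> _")
proof
  assume ?b
  then show "vi_solutions K H \<noteq> {}"
    using vi_solution_if_nonneg_on_frontier[OF assms] by (metis IntE IntI)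
next
  assume "vi_solutions K H \<noteq> {}"
  then obtain z where z: "z \<in> vi_solutions K H" by blast
  then have "z \<in> K" by (simp add: vi_solutions_def)
  then show ?b
    using vi_solution_imp_dual_solution[OF pm z]
    by (intro exI[of _ "ball z 1"] conjI bexI[of _ z]) auto
qed

lemma exists_bounded_sublevel_iff_vi_solution:
  fixes H :: "'a::euclidean_space \<Rightarrow> 'a"
  assumes "closed K" and "convex K" and "continuous_on K H" and pm: "pseudomonotone K H"
  shows "(\<exists>xh\<in>K. bounded {x \<in> K. H x \<bullet> (x - xh) < 0}) \<longleftrightarrow> vi_solutions K H \<noteq> {}"
    (is "?a \<longleftrightarrow> _")
proof
  assume ?a
  then obtain xh where xh: "xh \<in> K" "bounded {x \<in> K. H x \<bullet> (x - xh) < 0}" by blast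
  then obtain R where "{x \<in> K. H x \<bullet> (x - xh) < 0} \<subseteq> ball xh R"
    using bounded_subset_ballD by blast
  \<comment> \<open>The radius is enlarged to be positive, in case the sublevel set is empty.\<close>
  then have "0 \<le> H x \<bullet> (x - xh)" if "x \<in> K" "x \<in> frontier (ball xh (max R 1))" for x
    using that by (force simp: subset_iff)
  then show "vi_solutions K H \<noteq> {}"
    using xh(1) by (intro vi_solution_if_nonneg_on_frontier[OF assms, of "ball xh (max R 1)" xh]) auto
next
  assume "vi_solutions K H \<noteq> {}"
  then obtain z where z: "z \<in> vi_solutions K H" by blast
  then have "z \<in> K" by (simp add: vi_solutions_def)
  have empty: "{x \<in> K. H x \<bullet> (x - z) < 0} = {}"
    using vi_solution_imp_dual_solution[OF pm z] by force
  show ?a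
    by (rule bexI[OF _ \<open>z \<in> K\<close>]) (simp only: empty bounded_empty)
qed

lemma closed_vi_solutions:
  fixes H :: "'a::real_inner \<Rightarrow> 'a"
  assumes "closed K" and "continuous_on K H"
  shows "closed (vi_solutions K H)"
proof -
  have "closed {x \<in> K. 0 \<le> H x \<bullet> (y - x)}" for y
    using assms
    by (intro continuous_on_closed_Collect_le) (auto intro!: continuous_intros)
  then have "closed (K \<inter> (\<Inter>y\<in>K. {x \<in> K. 0 \<le> H x \<bullet> (y - x)}))"
    using assms(1) by (intro closed_Int closed_INT) auto
  moreover have "vi_solutions K H = K \<inter> (\<Inter>y\<in>K. {x \<in> K. 0 \<le> H x \<bullet> (y - x)})"
    by (auto simp: vi_solutions_def)
  ultimately show ?thesis by simp
qed

text \<open>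
  Testing a solution against \<open>xh\<close> shows that all solutions lie in the weak sublevel set.
\<close>

lemma vi_solutions_compact_if_bounded_sublevel:
  fixes H :: "'a::euclidean_space \<Rightarrow> 'a"
  assumes "closed K" and "continuous_on K H" and "xh \<in> K"
    and "bounded {x \<in> K. H x \<bullet> (x - xh) \<le> 0}"
  shows "compact (vi_solutions K H)"
proof -
  have "vi_solutions K H \<subseteq> {x \<in> K. H x \<bullet> (x - xh) \<le> 0}"
    using assms(3) by (auto simp: vi_solutions_def inner_diff_right)
  then have "bounded (vi_solutions K H)"
    using assms(4) bounded_subset by blast
  then show ?thesis
    using closed_vi_solutions[OF assms(1,2)] by (simp add: compact_eq_bounded_closed)
qed

section \<open>The stochastic setting\<close>

lemma winner_commute: "winner p x y = winner p y x"
  by (simp add: winner_def inner_commute)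

lemma winner_eq_inner_weighted: "winner p x y = (\<chi> \<xi>. p \<xi> *\<^sub>R x $ \<xi>) \<bullet> y"
  by (simp add: winner_def inner_vec_def[where 'a = "real ^ 'n"])

lemma SOL_eq_vi_solutions: "SOL p K G = vi_solutions K (\<lambda>x. \<chi> \<xi>. p \<xi> *\<^sub>R G x $ \<xi>)"
  by (auto simp: SOL_iff vi_solutions_def winner_eq_inner_weighted)

lemma pseudomonotone_on_iff:
  "pseudomonotone_on p K G \<longleftrightarrow> pseudomonotone K (\<lambda>x. \<chi> \<xi>. p \<xi> *\<^sub>R G x $ \<xi>)"
  unfolding pseudomonotone_on_def pseudomonotone_def
  by (subst (1 2) winner_commute) (simp only: winner_eq_inner_weighted)

lemma subspace_nonanticipative: "subspace (nonanticipative N stg coord)"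
  unfolding subspace_def nonanticipative_def
  by (simp, metis)

lemma constraint_set_eq_INT_vimage: "constraint_set C = (\<Inter>\<xi>. (\<lambda>x. x $ \<xi>) -` C \<xi>)"
  by (auto simp: constraint_set_def)

lemma closed_constraint_set:
  assumes "\<And>\<xi>. closed (C \<xi>)"
  shows "closed (constraint_set C)"
  unfolding constraint_set_eq_INT_vimage
  using assms by (intro closed_INT ballI closed_vimage continuous_intros)

lemma convex_constraint_set:
  assumes "\<And>\<xi>. convex (C \<xi>)"
  shows "convex (constraint_set C)"
  unfolding constraint_set_eq_INT_vimage
  using assms
  by (intro convex_INT convex_linear_vimage bounded_linear.linear[OF bounded_linear_vec_nth])

theorem theorem5:
  fixes N :: nat and nk :: "nat \<Rightarrow> nat"
    and stg :: "'n::finite \<Rightarrow> nat"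
    and Xi :: "nat \<Rightarrow> 's set" and coord :: "'xi::finite \<Rightarrow> nat \<Rightarrow> 's"
    and p :: "'xi \<Rightarrow> real"
    and C :: "'xi \<Rightarrow> (real ^ 'n) set"
    and F :: "real ^ 'n \<Rightarrow> 'xi \<Rightarrow> real ^ 'n"
    and \<F> :: "real ^ 'n ^ 'xi \<Rightarrow> real ^ 'n ^ 'xi"
    and K :: "(real ^ 'n ^ 'xi) set"
  assumes "N \<ge> 1" and "\<forall>k\<in>{1..N}. nk k \<ge> 1"
    and "\<forall>i. stg i \<in> {1..N}" and "\<forall>k\<in>{1..N}. card {i. stg i = k} = nk k"
    and "bij_betw coord UNIV (PiE {1..N} Xi)"
    and "\<forall>\<xi>. p \<xi> > 0" and "(\<Sum>\<xi>\<in>UNIV. p \<xi>) = 1"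
    and "\<forall>\<xi>. C \<xi> \<noteq> {} \<and> closed (C \<xi>) \<and> convex (C \<xi>)"
    and "\<F> = pointwise_map F"
    and "K = constraint_set C \<inter> nonanticipative N stg coord"
    and "continuous_on UNIV \<F>"
    and "pseudomonotone_on p K \<F>"
  shows
    "((\<exists>xh\<in>K. bounded {x \<in> K. winner p (\<F> x) (x - xh) < 0}) \<longleftrightarrow>
      (\<exists>\<Omega>. bounded \<Omega> \<and> open \<Omega> \<and>
         (\<exists>xh\<in>K \<inter> \<Omega>. \<forall>x\<in>K \<inter> frontier \<Omega>. winner p (\<F> x) (x - xh) \<ge> 0)))
     \<and>
     ((\<exists>\<Omega>. bounded \<Omega> \<and> open \<Omega> \<and>
         (\<exists>xh\<in>K \<inter> \<Omega>. \<forall>x\<in>K \<inter> frontier \<Omega>. winner p (\<F> x) (x - xh) \<ge> 0)) \<longleftrightarrow>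
      SOL p K \<F> \<noteq> {})
     \<and>
     ((\<exists>xh\<in>K. bounded {x \<in> K. winner p (\<F> x) (x - xh) \<le> 0}) \<longrightarrow>
      SOL p K \<F> \<noteq> {} \<and> compact (SOL p K \<F>))"
proof -
  let ?H = "\<lambda>x. \<chi> \<xi>. p \<xi> *\<^sub>R \<F> x $ \<xi>"
  have "closed K" "convex K"
    unfolding assms(10)
    using assms(8) subspace_nonanticipative[of N stg coord]
    by (simp_all add: closed_Int convex_Int closed_constraint_set convex_constraint_set
        closed_subspace subspace_imp_convex)
  moreover have cont: "continuous_on K ?H"
    by (intro continuous_intros continuous_on_subset[OF assms(11)]) auto
  moreover have "pseudomonotone K ?H"
    using assms(12) by (simp add: pseudomonotone_on_iff)
  ultimately have a: "(\<exists>xh\<in>K. bounded {x \<in> K. ?H x \<bullet> (x - xh) < 0}) \<longleftrightarrow> vi_solutions K ?H \<noteq> {}"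
    and b: "(\<exists>\<Omega>. bounded \<Omega> \<and> open \<Omega> \<and>
      (\<exists>xh\<in>K \<inter> \<Omega>. \<forall>x\<in>K \<inter> frontier \<Omega>. 0 \<le> ?H x \<bullet> (x - xh))) \<longleftrightarrow> vi_solutions K ?H \<noteq> {}"
    by (rule exists_bounded_sublevel_iff_vi_solution, rule exists_open_bounded_iff_vi_solution)
  have "vi_solutions K ?H \<noteq> {} \<and> compact (vi_solutions K ?H)"
    if xh: "xh \<in> K" "bounded {x \<in> K. ?H x \<bullet> (x - xh) \<le> 0}" for xh
  proof
    have "bounded {x \<in> K. ?H x \<bullet> (x - xh) < 0}"
      by (rule bounded_subset[OF xh(2)]) auto
    with a xh(1) show "vi_solutions K ?H \<noteq> {}" by blast
    show "compact (vi_solutions K ?H)"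
      using vi_solutions_compact_if_bounded_sublevel[OF \<open>closed K\<close> cont xh] .
  qed
  with a b show ?thesis
    unfolding SOL_eq_vi_solutions winner_eq_inner_weighted by blast
qed

end
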